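(* For each positive integer $n$, let $V_n$ be the set of permutations $w\in S_n$ whose Schensted insertion produces no lateral bumps. Then \[\lim_{n\to\infty}\frac{|V_n|}{n!}=0.\]
   Context: Schensted insertion (French notation, rows numbered from the bottom): given $w=w_1w_2\cdots w_n\in S_n$ in one-line notation, start from the empty tableau and insert $w_1,\dots,w_n$ in turn. To insert a number $x$ into a row: if $x$ is larger than every entry of the row (or the row is empty), append $x$ at the end of the row; otherwise $x$ replaces the smallest entry $y$ of the row that is greater than $x$, and $y$ is "bumped" and inserted into the next row up by the same rule (a new row is created if needed). The result is a standard Young tableau. A bump of a number $y$ out of column $j$ of some row is called vertical if $y$ is then placed (by replacement or by appending) in column $j$ of the next row up; otherwise it is called lateral (in which case $y$ lands in a column strictly to the left of $j$). *)

theory Defs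
  imports Complex_Main "HOL-Combinatorics.Permutations"
begin

text \<open>
  A tableau is the list of its rows, bottom row first (French notation).
  Rows and columns are indexed from 0.
\<close>

text \<open>
  The column in which \<open>x\<close> is placed when inserted into the row \<open>r\<close>: \<open>length r\<close> means that \<open>x\<close>
  is appended, a smaller value means that \<open>x\<close> replaces the entry in that column. Entries of a
  row are distinct for the insertion of a permutation, so the column of the replaced entry is
  then unique and the LEAST merely selects it.
\<close>

definition insertion_col :: "nat \<Rightarrow> nat list \<Rightarrow> nat" where
  "insertion_col x r =
     (if \<forall>y\<in>set r. y < x then length r
      else LEAST j. j < length r \<and> r ! j = Min {y \<in> set r. x < y})"

fun schensted_insert :: "nat \<Rightarrow> nat list list \<Rightarrow> nat list list" where
  "schensted_insert x [] = [[x]]"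
| "schensted_insert x (r # T) =
     (let j = insertion_col x r in
      if j = length r then (r @ [x]) # T
      else r[j := x] # schensted_insert (r ! j) T)"

text \<open>
  Columns in which the successive numbers are placed, row by row from the bottom,
  while \<open>x\<close> is inserted into a tableau. Thus the \<open>i\<close>-th bump of the insertion moves a number from
  column \<open>insertion_path x T ! i\<close> of row \<open>i\<close> to column \<open>insertion_path x T ! Suc i\<close> of row \<open>Suc i\<close>.
\<close>

fun insertion_path :: "nat \<Rightarrow> nat list list \<Rightarrow> nat list" where
  "insertion_path x [] = [0]"
| "insertion_path x (r # T) =
     (let j = insertion_col x r in
      if j = length r then [j]
      else j # insertion_path (r ! j) T)"

definition has_lateral_bump :: "nat \<Rightarrow> nat list list \<Rightarrow> bool" where
  "has_lateral_bump x T \<longleftrightarrow>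
     (\<exists>i. Suc i < length (insertion_path x T) \<and>
          insertion_path x T ! i \<noteq> insertion_path x T ! Suc i)"

definition insertion_tableau :: "nat list \<Rightarrow> nat list list" where
  "insertion_tableau w = fold schensted_insert w []"

definition no_lateral_bumps :: "nat list \<Rightarrow> bool" where
  "no_lateral_bumps w \<longleftrightarrow>
     (\<forall>k < length w. \<not> has_lateral_bump (w ! k) (insertion_tableau (take k w)))"

definition one_line :: "nat \<Rightarrow> (nat \<Rightarrow> nat) \<Rightarrow> nat list" where
  "one_line n p = map p [1..<Suc n]"

definition V :: "nat \<Rightarrow> (nat \<Rightarrow> nat) set" where
  "V n = {p. p permutes {1..n} \<and> no_lateral_bumps (one_line n p)}"

end

theory Submission
  imports Defs "HOL-Analysis.Harmonic_Numbers" "HOL-Real_Asymp.Real_Asymp"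
begin

text \<open>
  Without lateral bumps, the whole insertion of a number takes place in one column. So a new row
  arises only from an insertion in column 0, that is, from a left-to-right minimum, and no row
  outgrows the bottom row, whose length is witnessed by an increasing subsequence. Since the
  tableau has \<open>n\<close> cells, the permutation has an increasing subsequence of length \<open>l\<close> or at least
  \<open>n / l\<close> left-to-right minima. By the first moment method the proportions of such permutations
  are at most \<open>n\<^sup>l / (l!)\<^sup>2 \<le> (e\<^sup>2 n / l\<^sup>2)\<^sup>l\<close> and \<open>(1 + ln n) l / n\<close>, and both tend to \<open>0\<close> for
  \<open>l\<close> about \<open>n\<close> to the power \<open>3/4\<close>.
\<close>

section \<open>Insertion into the bottom row and along a single column\<close>

definition first_row :: "nat list list \<Rightarrow> nat list" where
  "first_row T = (case T of [] \<Rightarrow> [] | r # _ \<Rightarrow> r)"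

definition row_insert :: "nat \<Rightarrow> nat list \<Rightarrow> nat list" where
  "row_insert x r =
     (if insertion_col x r = length r then r @ [x] else r[insertion_col x r := x])"

text \<open>In a sorted row the smallest entry above \<open>x\<close> is also the leftmost one, so
  the insertion column separates smaller entries from larger ones. This form by positions replaces
  \<open>Min\<close> and \<open>LEAST\<close> in the analysis of the bottom row.\<close>

lemma sorted_insertion_col:
  assumes "sorted_wrt (<) r" "x \<notin> set r"
  shows "insertion_col x r \<le> length r"
    and "\<And>i. i < insertion_col x r \<Longrightarrow> r ! i < x"
    and "insertion_col x r < length r \<Longrightarrow> x < r ! insertion_col x r"
proof -
  have "insertion_col x r \<le> length r \<and> (\<forall>i < insertion_col x r. r ! i < x) \<and>
        (insertion_col x r < length r \<longrightarrow> x < r ! insertion_col x r)"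
  proof (cases "\<forall>y\<in>set r. y < x")
    case True
    then show ?thesis by (simp add: insertion_col_def)
  next
    case False
    let ?B = "{y \<in> set r. x < y}"
    let ?P = "\<lambda>j. j < length r \<and> r ! j = Min ?B"
    have ne: "?B \<noteq> {}" using False assms(2) by (metis (mono_tags, lifting) empty_Collect_eq linorder_neqE)
    have "Min ?B \<in> ?B" using ne by (intro Min_in) auto
    then obtain j where "?P j" by (auto simp: in_set_conv_nth)
    then have P: "?P (insertion_col x r)"
      using False LeastI[of ?P j] by (simp add: insertion_col_def)
    have "r ! i < x" if "i < insertion_col x r" for i
    proof (rule ccontr)
      assume "\<not> r ! i < x"
      moreover have "r ! i \<in> set r" using that P by simp
      ultimately have "r ! i \<in> ?B" using assms(2) by (cases "r ! i = x") auto
      then have "Min ?B \<le> r ! i" by (intro Min_le) auto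
      moreover have "r ! i < r ! insertion_col x r"
        using that P assms(1) unfolding sorted_wrt_iff_nth_less by blast
      ultimately show False using P by simp
    qed
    then show ?thesis using P \<open>Min ?B \<in> ?B\<close> by auto
  qed
  then show "insertion_col x r \<le> length r"
    and "\<And>i. i < insertion_col x r \<Longrightarrow> r ! i < x"
    and "insertion_col x r < length r \<Longrightarrow> x < r ! insertion_col x r" by auto
qed

text \<open>The empty tableau behaves like an empty bottom row, to which \<open>x\<close> is
  appended in column 0; hence both cases obey one formula.\<close>

lemma first_row_schensted_insert:
  "first_row (schensted_insert x T) = row_insert x (first_row T)"
  by (cases T) (auto simp: first_row_def row_insert_def insertion_col_def Let_def)

lemma sum_length_schensted_insert:
  "sum_list (map length (schensted_insert x T)) = Suc (sum_list (map length T))"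
  by (induction x T rule: schensted_insert.induct) (auto simp: Let_def)

lemma insertion_path_nth_0: "insertion_path x T ! 0 = insertion_col x (first_row T)"
  by (cases T) (auto simp: first_row_def insertion_col_def Let_def)

text \<open>The absence of lateral bumps enters the argument here: consecutive columns of the path
  agree, so the column in the bottom row is carried to the end of the path.\<close>

lemma insertion_path_constant:
  assumes "\<not> has_lateral_bump x T" "c \<in> set (insertion_path x T)"
  shows "c = insertion_col x (first_row T)"
proof -
  have "insertion_path x T ! i = insertion_path x T ! 0" if "i < length (insertion_path x T)" for i
    using that
  proof (induction i)
    case (Suc i)
    then show ?case using assms(1) by (simp add: has_lateral_bump_def)
  qed simp
  then show ?thesis using assms(2) by (metis in_set_conv_nth insertion_path_nth_0)
qed

text \<open>Only the row where the path ends changes its length. Its new cell lies in column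
  \<open>j\<close>, so its new length is \<open>Suc j\<close>.\<close>

lemma length_rows_schensted_insert:
  assumes "\<And>c. c \<in> set (insertion_path x T) \<Longrightarrow> c = j" "Suc j \<le> L"
    "\<And>r. r \<in> set T \<Longrightarrow> length r \<le> L" "r \<in> set (schensted_insert x T)"
  shows "length r \<le> L"
  using assms
  by (induction x T arbitrary: r rule: schensted_insert.induct) (auto simp: Let_def split: if_splits)

text \<open>A new row is started in column 0, so a path that stays in another column ends in an
  existing row.\<close>

lemma length_schensted_insert:
  assumes "\<And>c. c \<in> set (insertion_path x T) \<Longrightarrow> c = j"
  shows "length (schensted_insert x T) \<le> length T + (if j = 0 then 1 else 0)"
  using assms
  by (induction x T rule: schensted_insert.induct) (auto simp: Let_def split: if_splits)

section \<open>Left-to-right minima and increasing subsequences seen in the tableau\<close>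

definition left_right_minima :: "nat \<Rightarrow> (nat \<Rightarrow> nat) \<Rightarrow> nat set" where
  "left_right_minima n p = {k \<in> {1..n}. \<forall>i\<in>{1..<k}. p k < p i}"

lemma one_line_Suc: "one_line (Suc k) p = one_line k p @ [p (Suc k)]"
  by (simp add: one_line_def)

lemma insertion_tableau_Suc:
  "insertion_tableau (one_line (Suc k) p) =
     schensted_insert (p (Suc k)) (insertion_tableau (one_line k p))"
  by (simp add: one_line_Suc insertion_tableau_def)

lemma no_lateral_bumps_Suc:
  assumes "no_lateral_bumps (one_line (Suc k) p)"
  shows "no_lateral_bumps (one_line k p)"
    and "\<not> has_lateral_bump (p (Suc k)) (insertion_tableau (one_line k p))"
proof -
  let ?w = "one_line k p"
  have *: "\<not> has_lateral_bump ((?w @ [p (Suc k)]) ! i) (insertion_tableau (take i (?w @ [p (Suc k)])))"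
    if "i < Suc (length ?w)" for i
    using assms that by (simp add: no_lateral_bumps_def one_line_Suc)
  show "no_lateral_bumps ?w"
    unfolding no_lateral_bumps_def
  proof (intro allI impI)
    fix i assume "i < length ?w"
    then show "\<not> has_lateral_bump (?w ! i) (insertion_tableau (take i ?w))"
      using *[of i] by (simp add: nth_append)
  qed
  show "\<not> has_lateral_bump (p (Suc k)) (insertion_tableau ?w)"
    using *[of "length ?w"] by simp
qed

text \<open>A subsequence is a set \<open>S\<close> of positions, which suits the later count over
  subsets. Keeping track of the value \<open>y\<close> at its last position \<open>m\<close> tells
  which new values can extend it.\<close>

definition increasing_ending_in :: "(nat \<Rightarrow> nat) \<Rightarrow> nat \<Rightarrow> nat \<Rightarrow> nat \<Rightarrow> bool" where
  "increasing_ending_in p k l y \<longleftrightarrow>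
     (\<exists>S m. S \<subseteq> {1..k} \<and> card S = l \<and> strict_mono_on S p \<and> m \<in> S \<and> p m = y \<and> (\<forall>i\<in>S. i \<le> m))"

lemma increasing_ending_in_Suc:
  assumes "increasing_ending_in p k l y"
  shows "increasing_ending_in p (Suc k) l y"
proof -
  have "{1..k} \<subseteq> {1..Suc k}" by auto
  from subset_trans[OF _ this] show ?thesis
    using assms unfolding increasing_ending_in_def by blast
qed

lemma increasing_ending_in_single: "increasing_ending_in p (Suc k) 1 (p (Suc k))"
  unfolding increasing_ending_in_def
  by (intro exI[of _ "{Suc k}"] exI[of _ "Suc k"]) (auto simp: strict_mono_on_def)

lemma increasing_ending_in_extend:
  assumes "increasing_ending_in p k l y" "y < p (Suc k)"
  shows "increasing_ending_in p (Suc k) (Suc l) (p (Suc k))"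
proof -
  obtain S m where S: "S \<subseteq> {1..k}" "card S = l" "strict_mono_on S p" "m \<in> S" "p m = y"
    and m: "\<forall>i\<in>S. i \<le> m"
    using assms(1) unfolding increasing_ending_in_def by blast
  have fin: "finite S" using S(1) finite_subset by blast
  have below: "a < Suc k \<and> p a < p (Suc k)" if "a \<in> S" for a
  proof
    show "a < Suc k" using that S(1) by auto
    have "p a \<le> p m" using that m S(3,4) by (metis order_le_less strict_mono_onD)
    then show "p a < p (Suc k)" using S(5) assms(2) by simp
  qed
  have "strict_mono_on (insert (Suc k) S) p"
    using S(3) below by (auto simp: strict_mono_on_def dest: less_asym)
  moreover have "Suc k \<notin> S" using below by blast
  ultimately show ?thesis
    unfolding increasing_ending_in_def using S(1,2) fin below
    by (intro exI[of _ "insert (Suc k) S"] exI[of _ "Suc k"]) (auto intro: less_imp_le)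
qed

text \<open>Induction on the number of insertions. The third part is the classical fact that an
  entry in column \<open>j\<close> of the bottom row ends an increasing subsequence of length
  \<open>j + 1\<close>. The fourth will identify insertions in column 0 as left-to-right minima. The
  second ensures that the next value is new to the row.\<close>

lemma first_row_invariant:
  fixes p :: "nat \<Rightarrow> nat"
  assumes "inj p"
  defines "R \<equiv> \<lambda>k. first_row (insertion_tableau (one_line k p))"
  shows "sorted_wrt (<) (R k) \<and> set (R k) \<subseteq> p ` {1..k} \<and>
    (\<forall>j < length (R k). increasing_ending_in p k (Suc j) (R k ! j)) \<and>
    (\<forall>i\<in>{1..k}. R k \<noteq> [] \<and> R k ! 0 \<le> p i)"
    (is "?sorted k \<and> ?sub k \<and> ?inc k \<and> ?min k")
proof (induction k)
  case 0
  then show ?case by (simp add: R_def first_row_def insertion_tableau_def one_line_def)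
next
  case (Suc k)
  define r where "r = R k"
  define x where "x = p (Suc k)"
  define j where "j = insertion_col x r"
  have Rk: "R k = r" by (simp add: r_def)
  have RS: "R (Suc k) = row_insert x r"
    by (simp add: r_def x_def R_def insertion_tableau_Suc first_row_schensted_insert)
  have srt: "sorted_wrt (<) r" and sub: "set r \<subseteq> p ` {1..k}" and inc: "?inc k" and mn: "?min k"
    using Suc.IH by (auto simp: r_def)
  have x: "x \<notin> set r"
    using sub injD[OF assms(1)] by (fastforce simp: x_def)
  note col = sorted_insertion_col[OF srt x, folded j_def]
  have R': "R (Suc k) = (if j = length r then r @ [x] else r[j := x])"
    by (simp add: RS row_insert_def j_def)
  have nth: "R (Suc k) ! i = (if i = j then x else r ! i)" if "i < length (R (Suc k))" for i
    using that by (auto simp: R' nth_append split: if_splits)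
  have len: "length (R (Suc k)) = (if j = length r then Suc (length r) else length r)"
    by (simp add: R')
  have xl: "x < r ! i" if "j \<le> i" "i < length r" for i
  proof (cases "i = j")
    case False
    then have "r ! j < r ! i" using that srt by (simp add: sorted_wrt_iff_nth_less)
    then show ?thesis using col(3) that by simp
  qed (use col that in simp)
  have "?sorted (Suc k)"
    unfolding sorted_wrt_iff_nth_less
  proof (intro allI impI)
    fix a b assume ab: "a < b" "b < length (R (Suc k))"
    show "R (Suc k) ! a < R (Suc k) ! b"
      using ab col(1) col(2)[of a] xl[of b] srt
      by (auto simp: nth sorted_wrt_iff_nth_less) (auto simp: len split: if_splits)
  qed
  moreover have "?sub (Suc k)"
  proof -
    have "set (R (Suc k)) \<subseteq> insert x (set r)" by (auto simp: R' dest: set_update_subset_insert[THEN subsetD])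
    then show ?thesis using sub by (force simp: x_def)
  qed
  moreover have "?inc (Suc k)"
  proof (intro allI impI)
    fix i assume i: "i < length (R (Suc k))"
    show "increasing_ending_in p (Suc k) (Suc i) (R (Suc k) ! i)"
    proof (cases "i = j")
      case False
      then have "i < length r" using i by (auto simp: len split: if_splits)
      then show ?thesis using False i inc by (simp add: nth Rk increasing_ending_in_Suc)
    next
      case True
      then have x: "R (Suc k) ! i = p (Suc k)" using i by (simp add: nth x_def)
      show ?thesis
      proof (cases j)
        case 0
        then show ?thesis using True x increasing_ending_in_single by simp
      next
        case (Suc j')
        \<comment> \<open>The left neighbour of the new entry is smaller and ends a subsequence of
          length \<open>j\<close>, which the new value extends.\<close>
        then have "increasing_ending_in p k j (r ! j')" "r ! j' < p (Suc k)"
          using inc col(1) col(2)[of j'] by (simp_all add: Rk x_def)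
        then show ?thesis using increasing_ending_in_extend True x by metis
      qed
    qed
  qed
  moreover have "?min (Suc k)"
  proof
    fix i assume i: "i \<in> {1..Suc k}"
    have ne: "R (Suc k) \<noteq> []" using col(1) by (auto simp: R')
    \<comment> \<open>Either \<open>x\<close> takes column 0 and is below any entry it replaces, or
      the old entry stays there and is below \<open>x\<close>.\<close>
    have le: "R (Suc k) ! 0 \<le> x" "r \<noteq> [] \<Longrightarrow> R (Suc k) ! 0 \<le> r ! 0"
      using nth[of 0] ne col(2)[of 0] xl[of 0] by (auto split: if_splits)
    show "R (Suc k) \<noteq> [] \<and> R (Suc k) ! 0 \<le> p i"
    proof (cases "i = Suc k")
      case False
      then have "i \<in> {1..k}" using i by auto
      then show ?thesis using mn le ne unfolding Rk by fastforce
    qed (use le ne in \<open>simp add: x_def\<close>)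
  qed
  ultimately show ?case by blast
qed

text \<open>Each insertion keeps to the column \<open>j\<close> of its step in the bottom row. A new
  row forces \<open>j = 0\<close>, hence a new left-to-right minimum, and no row can reach past the
  bottom row.\<close>

lemma tableau_shape:
  assumes "inj p" "no_lateral_bumps (one_line k p)"
  shows "length (insertion_tableau (one_line k p)) \<le> card (left_right_minima k p) \<and>
    sum_list (map length (insertion_tableau (one_line k p))) = k \<and>
    (\<forall>r\<in>set (insertion_tableau (one_line k p)).
       length r \<le> length (first_row (insertion_tableau (one_line k p))))"
  using assms(2)
proof (induction k)
  case 0
  then show ?case by (simp add: insertion_tableau_def one_line_def)
next
  case (Suc k)
  note nl = no_lateral_bumps_Suc[OF Suc.prems]
  define T where "T = insertion_tableau (one_line k p)"
  define T' where "T' = insertion_tableau (one_line (Suc k) p)"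
  note IH = Suc.IH[OF nl(1), folded T_def]
  define x where "x = p (Suc k)"
  define r where "r = first_row (T)"
  define j where "j = insertion_col x r"
  have TS: "T' = schensted_insert x (T)"
    by (simp add: T'_def T_def x_def insertion_tableau_Suc)
  note inv = first_row_invariant[OF assms(1), of k, folded T_def r_def]
  have x: "x \<notin> set r"
  proof
    assume "x \<in> set r"
    then obtain i where "i \<in> {1..k}" "p (Suc k) = p i" using inv unfolding x_def by blast
    then show False using injD[OF assms(1)] by fastforce
  qed
  note col = sorted_insertion_col[OF conjunct1[OF inv] x, folded j_def]
  have path: "c = j" if "c \<in> set (insertion_path x (T))" for c
    using insertion_path_constant[OF _ that] nl(2) by (simp add: j_def r_def x_def T_def)
  have fr: "first_row (T') = (if j = length r then r @ [x] else r[j := x])"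
    by (simp add: TS first_row_schensted_insert row_insert_def r_def j_def)
  \<comment> \<open>With \<open>j = 0\<close> and earlier values present, \<open>x\<close> bumps
    \<open>r ! 0\<close>, which is at most each of them.\<close>
  have "Suc k \<in> left_right_minima (Suc k) p" if "j = 0"
  proof -
    have "x < p i" if "i \<in> {1..k}" for i
    proof -
      from inv that have "r \<noteq> []" "r ! 0 \<le> p i" by blast+
      then show ?thesis using col(3) \<open>j = 0\<close> by simp
    qed
    then show ?thesis by (auto simp: left_right_minima_def x_def)
  qed
  moreover have "left_right_minima (Suc k) p - {Suc k} = left_right_minima k p"
    by (auto simp: left_right_minima_def)
  moreover have "finite (left_right_minima (Suc k) p)" by (simp add: left_right_minima_def)
  ultimately have "card (left_right_minima k p) + (if j = 0 then 1 else 0)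
      \<le> card (left_right_minima (Suc k) p)"
    by (metis Diff_subset Suc_eq_plus1 add.right_neutral card.remove card_mono order_refl)
  moreover have "length T' \<le> length T + (if j = 0 then 1 else 0)"
    unfolding TS by (rule length_schensted_insert[OF path])
  ultimately have "length (T') \<le> card (left_right_minima (Suc k) p)"
    using IH by linarith
  moreover have "sum_list (map length (T')) = Suc k"
    using IH by (simp add: TS sum_length_schensted_insert)
  moreover have "length a \<le> length (first_row (T'))" if "a \<in> set (T')" for a
  proof (rule length_rows_schensted_insert[OF path])
    \<comment> \<open>After the insertion \<open>x\<close> itself occupies column \<open>j\<close>
      of the bottom row.\<close>
    show "Suc j \<le> length (first_row (T'))" using col(1) by (simp add: fr)
    show "length b \<le> length (first_row (T'))" if "b \<in> set (T)" for b
      using IH that by (fastforce simp: fr r_def)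
    show "a \<in> set (schensted_insert x (T))" using that TS by simp
  qed
  ultimately show ?case unfolding T'_def by blast
qed

text \<open>A bottom row with at least \<open>l\<close> cells yields the increasing subsequence
  through its column \<open>l - 1\<close>. Otherwise all rows have fewer than \<open>l\<close>
  cells, and the \<open>n\<close> cells are spread over at most as many rows as there are
  minima.\<close>

lemma V_cases:
  assumes "p \<in> V n"
  shows "(\<exists>S \<subseteq> {1..n}. card S = l \<and> strict_mono_on S p) \<or>
         n \<le> card (left_right_minima n p) * l"
proof -
  define T where "T = insertion_tableau (one_line n p)"
  have perm: "p permutes {1..n}" and nl: "no_lateral_bumps (one_line n p)"
    using assms by (auto simp: V_def)
  have "inj p" using perm by (rule permutes_inj)
  note sh = tableau_shape[OF this nl, folded T_def]
  note inv = first_row_invariant[OF \<open>inj p\<close>, of n, folded T_def]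
  show ?thesis
  proof (cases "l \<le> length (first_row T)")
    case True
    show ?thesis
    proof (cases l)
      case 0
      then show ?thesis by (intro disjI1 exI[of _ "{}"]) (auto simp: strict_mono_on_def)
    next
      case (Suc j)
      with inv True have "increasing_ending_in p n l (first_row T ! j)" by simp
      then show ?thesis unfolding increasing_ending_in_def by blast
    qed
  next
    case False
    have "n = sum_list (map length T)" using sh by simp
    also have "\<dots> \<le> sum_list (map (\<lambda>_. l) T)" using sh False by (intro sum_list_mono) fastforce
    also have "\<dots> = length T * l" by (simp add: sum_list_triv)
    also have "\<dots> \<le> card (left_right_minima n p) * l" using sh by simp
    finally show ?thesis ..
  qed
qed

section \<open>Counting by injections and first moments\<close>

text \<open>
  A permutation increasing on \<open>S\<close> is determined by its values off \<open>S\<close>, so composing it with the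
  rearrangements of \<open>S\<close> is injective.
\<close>

lemma card_strict_mono_on_permutations:
  fixes A :: "'a::linorder set"
  assumes "finite A" "S \<subseteq> A"
  shows "card {p. p permutes A \<and> strict_mono_on S p} * fact (card S) \<le> fact (card A)"
proof -
  let ?X = "{p. p permutes A \<and> strict_mono_on S p}" and ?Q = "{q. q permutes S}"
  have finS: "finite S" using assms finite_subset by blast
  have "inj_on (\<lambda>(p, q). p \<circ> q) (?X \<times> ?Q)"
  proof (clarsimp simp: inj_on_def)
    fix p q p' q'
    assume p: "p permutes A" "strict_mono_on S p" and p': "p' permutes A" "strict_mono_on S p'"
      and q: "q permutes S" and q': "q' permutes S" and eq: "p \<circ> q = p' \<circ> q'"
    have "p ` S = (p \<circ> q) ` S" using permutes_image[OF q] by (metis image_comp)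
    also have "\<dots> = p' ` S" unfolding eq using permutes_image[OF q'] by (metis image_comp)
    finally have img: "p ` S = p' ` S" .
    \<comment> \<open>An increasing map on \<open>S\<close> lists its image in increasing order, so
      it is determined on \<open>S\<close> by that image.\<close>
    have "map f (sorted_list_of_set S) = sorted_list_of_set (f ` S)" if "strict_mono_on S f"
      for f :: "'a \<Rightarrow> 'a"
    proof (rule strict_sorted_equal)
      have "sorted_wrt (<) (sorted_list_of_set S)" by simp
      then show "sorted_wrt (<) (map f (sorted_list_of_set S))"
        unfolding sorted_wrt_map
        by (rule sorted_wrt_mono_rel[rotated]) (use that finS in \<open>auto simp: strict_mono_on_def\<close>)
    qed (use finS in auto)
    from this[OF p(2)] this[OF p'(2)] img
    have "map p (sorted_list_of_set S) = map p' (sorted_list_of_set S)" by simp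
    then have "\<forall>s\<in>S. p s = p' s" using finS by simp
    moreover have "p s = p' s" if "s \<notin> S" for s
      using fun_cong[OF eq, of s] permutes_not_in[OF q that] permutes_not_in[OF q' that] by simp
    ultimately have pp: "p = p'" by (intro ext) blast
    moreover have "q = q'"
      using eq permutes_inj[OF p'(1)] unfolding pp by (auto simp: fun_eq_iff inj_def)
    ultimately show "p = p' \<and> q = q'" ..
  qed
  moreover have "(\<lambda>(p, q). p \<circ> q) ` (?X \<times> ?Q) \<subseteq> {p. p permutes A}"
    using permutes_compose permutes_subset[OF _ assms(2)] by auto
  ultimately have "card (?X \<times> ?Q) \<le> card {p. p permutes A}"
    using finite_permutations[OF assms(1)] by (intro card_inj_on_le)
  then show ?thesis
    using card_permutations[OF refl finS] card_permutations[OF refl assms(1)]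
    by (simp add: card_cartesian_product)
qed

text \<open>
  Exchanging positions \<open>i \<le> k\<close> and \<open>k\<close> moves the minimum of the first \<open>k\<close> values to position \<open>i\<close>,
  from which \<open>i\<close> and the permutation can be recovered.
\<close>

lemma card_left_right_minimum_at:
  assumes "k \<in> {1..n}"
  shows "card {p. p permutes {1..n} \<and> k \<in> left_right_minima n p} * k \<le> fact n"
proof -
  let ?X = "{p. p permutes {1..n} \<and> k \<in> left_right_minima n p}"
  let ?f = "\<lambda>(p, i). p \<circ> Transposition.transpose i k"
  have less: "(p \<circ> Transposition.transpose i k) i < (p \<circ> Transposition.transpose i k) m"
    if "p \<in> ?X" "i \<in> {1..k}" "m \<in> {1..k}" "m \<noteq> i" for p i m
  proof -
    have "Transposition.transpose i k m \<in> {1..<k}" using that by (auto simp: Transposition.transpose_def)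
    then show ?thesis using that by (auto simp: left_right_minima_def)
  qed
  have "inj_on ?f (?X \<times> {1..k})"
  proof (rule inj_onI, clarify)
    fix p i p' i'
    assume p: "p permutes {1..n}" "k \<in> left_right_minima n p" "i \<in> {1..k}"
      and p': "p' permutes {1..n}" "k \<in> left_right_minima n p'" "i' \<in> {1..k}"
      and eq: "p \<circ> Transposition.transpose i k = p' \<circ> Transposition.transpose i' k"
    have "i = i'"
    proof (rule ccontr)
      assume "i \<noteq> i'"
      \<comment> \<open>Positions \<open>i\<close> and \<open>i'\<close> would both carry the strict
        minimum of the first \<open>k\<close> values of the same composite.\<close>
      then show False using less[of p i i'] less[of p' i' i] p p' unfolding eq by auto
    qed
    moreover have "p = p'"
      using arg_cong[OF eq, of "\<lambda>g. g \<circ> Transposition.transpose i k"] \<open>i = i'\<close> by (simp add: comp_assoc)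
    ultimately show "p = p' \<and> i = i'" by simp
  qed
  moreover have "?f ` (?X \<times> {1..k}) \<subseteq> {p. p permutes {1..n}}"
    using assms by (auto intro!: permutes_compose permutes_swap_id)
  ultimately have "card (?X \<times> {1..k}) \<le> card {p. p permutes {1..n}}"
    by (intro card_inj_on_le) (auto simp: finite_permutations)
  then show ?thesis
    using card_permutations[of "{1..n}" n] by (simp add: card_cartesian_product)
qed

text \<open>Union bound: there are \<open>n choose l\<close> \<le> \<open>n ^ l / fact l\<close>
  position sets, and each is increasing for at most \<open>fact n / fact l\<close>
  permutations.\<close>

lemma card_increasing_le:
  "real (card {p. p permutes {1..n} \<and> (\<exists>S \<subseteq> {1..n}. card S = l \<and> strict_mono_on S p)})
     \<le> fact n * (real n ^ l / (fact l)\<^sup>2)"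
proof -
  let ?I = "\<lambda>S. {p. p permutes {1..n} \<and> strict_mono_on S p}"
  let ?F = "{S. S \<subseteq> {1..n} \<and> card S = l}"
  have "{p. p permutes {1..n} \<and> (\<exists>S \<subseteq> {1..n}. card S = l \<and> strict_mono_on S p)} = (\<Union>S\<in>?F. ?I S)"
    by blast
  then have "real (card {p. p permutes {1..n} \<and> (\<exists>S \<subseteq> {1..n}. card S = l \<and> strict_mono_on S p)})
      \<le> real (\<Sum>S\<in>?F. card (?I S))"
    by (simp only: of_nat_le_iff) (rule card_UN_le, simp)
  also have "\<dots> \<le> (\<Sum>S\<in>?F. fact n / fact l)"
    unfolding of_nat_sum
  proof (rule sum_mono)
    fix S assume "S \<in> ?F"
    then have "card (?I S) * fact l \<le> fact n"
      using card_strict_mono_on_permutations[of "{1..n}" S] by simp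
    then have "real (card (?I S) * fact l) \<le> real (fact n)" by (rule of_nat_mono)
    then show "real (card (?I S)) \<le> fact n / fact l" by (simp add: field_simps)
  qed
  also have "\<dots> = real (n choose l) * (fact n / fact l)"
    using n_subsets[of "{1..n}" l] by simp
  also have "\<dots> \<le> (real n ^ l / fact l) * (fact n / fact l)"
  proof (rule mult_right_mono)
    have "real ((n choose l) * fact l) \<le> real (n ^ l)"
      by (rule of_nat_mono) (rule binomial_fact_pow)
    then show "real (n choose l) \<le> real n ^ l / fact l" by (simp add: field_simps)
  qed simp
  finally show ?thesis by (simp add: power2_eq_square mult.commute)
qed

text \<open>Markov's inequality for the number of minima. Position \<open>k\<close> is a minimum for
  at most \<open>fact n / k\<close> permutations, so the total over all permutations is at most
  \<open>fact n * harm n\<close>.\<close>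

lemma card_many_minima_le:
  assumes "n > 0"
  shows "real (card {p. p permutes {1..n} \<and> n \<le> card (left_right_minima n p) * l})
     \<le> fact n * (real l * (1 + ln (real n)) / real n)"
proof -
  let ?P = "{p. p permutes {1..n}}"
  let ?M = "{p. p permutes {1..n} \<and> n \<le> card (left_right_minima n p) * l}"
  let ?X = "\<lambda>k. {p. p permutes {1..n} \<and> k \<in> left_right_minima n p}"
  have fin: "finite ?P" by (simp add: finite_permutations)
  have "card ?M * n = (\<Sum>p\<in>?M. n)" by simp
  also have "\<dots> \<le> (\<Sum>p\<in>?M. card (left_right_minima n p) * l)" by (rule sum_mono) simp
  also have "\<dots> \<le> (\<Sum>p\<in>?P. card (left_right_minima n p) * l)"
    using fin by (intro sum_mono2) auto
  also have "\<dots> = (\<Sum>p\<in>?P. card (left_right_minima n p)) * l" by (simp add: sum_distrib_right)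
  also have "(\<Sum>p\<in>?P. card (left_right_minima n p)) = (\<Sum>k\<in>{1..n}. card (?X k))"
  proof -
    have "(\<Sum>p\<in>?P. card (left_right_minima n p))
        = (\<Sum>p\<in>?P. card {k \<in> {1..n}. k \<in> left_right_minima n p})"
      by (intro sum.cong arg_cong[where f = card]) (auto simp: left_right_minima_def)
    also have "\<dots> = (\<Sum>k\<in>{1..n}. card {p \<in> ?P. k \<in> left_right_minima n p})"
      using fin by (intro sum_multicount_gen) auto
    finally show ?thesis by simp
  qed
  finally have "real (card ?M * n) \<le> real ((\<Sum>k\<in>{1..n}. card (?X k)) * l)" by (rule of_nat_mono)
  then have "real (card ?M) * real n \<le> (\<Sum>k\<in>{1..n}. real (card (?X k))) * real l" by simp
  also have "\<dots> \<le> (\<Sum>k\<in>{1..n}. fact n * inverse (real k)) * real l"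
  proof (intro mult_right_mono sum_mono)
    fix k assume k: "k \<in> {1..n}"
    have "real (card (?X k) * k) \<le> real (fact n)"
      by (rule of_nat_mono) (rule card_left_right_minimum_at[OF k])
    then show "real (card (?X k)) \<le> fact n * inverse (real k)" using k by (simp add: field_simps)
  qed simp
  also have "\<dots> = fact n * harm n * real l" by (simp add: harm_def sum_distrib_left)
  also have "\<dots> \<le> fact n * (1 + ln (real n)) * real l"
  proof -
    obtain m where "n = Suc m" using assms by (cases n) auto
    then have "harm n \<le> 1 + ln (real n)"
      \<comment> \<open>The difference \<open>harm n - ln n\<close> decreases from its value 1 at
        \<open>n = 1\<close>.\<close>
      using decseqD[OF decseq_harm_diff_ln, of 0 m] by (simp add: harm_def)
    then show ?thesis by (intro mult_right_mono mult_left_mono) auto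
  qed
  finally show ?thesis using assms by (simp add: field_simps)
qed

section \<open>Estimates and the limit\<close>

lemma power_le_exp_mult_fact: "real l ^ l \<le> exp 1 ^ l * fact l"
proof -
  \<comment> \<open>The left side is a single term of the exponential series at
    \<open>l\<close>.\<close>
  have "real l ^ l /\<^sub>R fact l \<le> (\<Sum>n. real l ^ n /\<^sub>R fact n)"
    using sum_le_suminf[OF summable_exp_generic, of "{l}" "real l"] by simp
  also have "\<dots> = exp 1 ^ l" by (simp add: exp_of_nat_mult[symmetric]) (simp add: exp_def)
  finally show ?thesis by (simp add: field_simps)
qed

text \<open>The increasing subsequences contribute at most \<open>?a ^ l\<close>, which is at most
  \<open>?a\<close> when \<open>?a\<close> \<le> 1. When \<open>?a\<close> exceeds 1, the bound is
  trivial for a proportion. This removes \<open>l\<close> from the exponent.\<close>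

lemma V_fraction_le:
  assumes "n > 0" "l > 0"
  shows "real (card (V n)) / fact n
     \<le> (exp 1)\<^sup>2 * real n / (real l)\<^sup>2 + real l * (1 + ln (real n)) / real n"
    (is "_ \<le> ?a + ?b")
proof (cases "?a \<le> 1")
  case True
  let ?I = "{p. p permutes {1..n} \<and> (\<exists>S \<subseteq> {1..n}. card S = l \<and> strict_mono_on S p)}"
  let ?M = "{p. p permutes {1..n} \<and> n \<le> card (left_right_minima n p) * l}"
  have fin: "finite ?I" "finite ?M"
    by (auto intro: finite_subset[OF _ finite_permutations[of "{1..n}"]])
  have "V n \<subseteq> ?I \<union> ?M" using V_cases by (auto simp: V_def)
  then have "card (V n) \<le> card (?I \<union> ?M)" using fin by (intro card_mono) auto
  also have "\<dots> \<le> card ?I + card ?M" by (rule card_Un_le)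
  finally have "real (card (V n)) \<le> real (card ?I) + real (card ?M)" by linarith
  also have "\<dots> \<le> fact n * (real n ^ l / (fact l)\<^sup>2) + fact n * ?b"
    by (intro add_mono card_increasing_le card_many_minima_le assms)
  also have "\<dots> = fact n * (real n ^ l / (fact l)\<^sup>2 + ?b)" by (simp add: distrib_left)
  finally have "real (card (V n)) / fact n \<le> real n ^ l / (fact l)\<^sup>2 + ?b"
    by (simp add: field_simps)
  moreover have "real n ^ l / (fact l)\<^sup>2 \<le> ?a ^ l"
  proof -
    have "(real l ^ l)\<^sup>2 \<le> (exp 1 ^ l * fact l)\<^sup>2"
      by (intro power_mono power_le_exp_mult_fact) simp
    then have "real n ^ l * (real l ^ l)\<^sup>2 \<le> real n ^ l * (exp 1 ^ l * fact l)\<^sup>2"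
      by (intro mult_left_mono) auto
    then show ?thesis using assms
      by (simp add: field_simps power_mult_distrib power_divide flip: power_mult)
  qed
  moreover have "?a ^ l \<le> ?a" using power_decreasing[of 1 l ?a] True assms by simp
  ultimately show ?thesis by linarith
next
  case False
  have "card (V n) \<le> card {p. p permutes {1..n}}"
    by (intro card_mono) (auto simp: V_def finite_permutations)
  then have "real (card (V n)) \<le> real (fact n)"
    using card_permutations[of "{1..n}" n] by (metis card_atLeastAtMost diff_Suc_1 finite_atLeastAtMost of_nat_mono)
  then have "real (card (V n)) / fact n \<le> 1" by simp
  moreover have "0 \<le> ?b" using assms by simp
  ultimately show ?thesis using False by linarith
qed

theorem theorem1p2:
  shows "(\<lambda>n. real (card (V n)) / fact n) \<longlonglongrightarrow> 0"
proof -
  \<comment> \<open>With \<open>l\<close> near \<open>n powr c\<close> the two terms have orders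
    \<open>n powr (1 - 2 * c)\<close> and \<open>n powr (c - 1) * ln n\<close>, so any
    \<open>c\<close> strictly between 1/2 and 1 serves; 3/4 is the midpoint. The added 1 in the
    second term absorbs the rounding of \<open>l\<close>.\<close>
  define b where "b = (\<lambda>n::nat. (exp 1)\<^sup>2 * real n / (real n powr (3/4))\<^sup>2
      + (real n powr (3/4) + 1) * (1 + ln (real n)) / real n :: real)"
  have "\<forall>\<^sub>F n in sequentially. real (card (V n)) / fact n \<le> b n"
    using eventually_gt_at_top[of 0]
  proof eventually_elim
    case (elim n)
    define l where "l = nat \<lceil>real n powr (3/4)\<rceil>"
    have "real n powr (3/4) > 0" using elim by simp
    then have l: "real n powr (3/4) \<le> real l" "real l \<le> real n powr (3/4) + 1" "l > 0"
      unfolding l_def by linarith+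
    have "(exp 1)\<^sup>2 * real n / (real l)\<^sup>2 \<le> (exp 1)\<^sup>2 * real n / (real n powr (3/4))\<^sup>2"
      using l elim by (intro divide_left_mono power_mono mult_pos_pos zero_less_power) auto
    moreover have "real l * (1 + ln (real n)) / real n
        \<le> (real n powr (3/4) + 1) * (1 + ln (real n)) / real n"
      using l elim by (intro divide_right_mono mult_right_mono) auto
    ultimately show ?case
      using V_fraction_le[OF elim l(3)] unfolding b_def by linarith
  qed
  moreover have "b \<longlonglongrightarrow> 0" unfolding b_def by real_asymp
  ultimately show ?thesis
    by (rule tendsto_sandwich[OF always_eventually _ tendsto_const, rotated]) simp
qed

end
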